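(* If $X\in 2^\omega$ is Martin-Löf random with respect to some computable, continuous measure $\mu$ on $2^\omega$, then $X$ is complex.
   Context: All measures are Borel probability measures on Cantor space $2^\omega$. For a finite binary string $\sigma\in 2^{<\omega}$ write $\mu(\sigma)$ for $\mu(\{X\in 2^\omega : \sigma\prec X\})$. A measure $\mu$ is computable if $\sigma\mapsto\mu(\sigma)$ is a computable real-valued function (uniformly approximable by dyadic rationals to within $2^{-i}$). A measure $\mu$ is continuous if $\mu(\{X\})=0$ for all $X\in 2^\omega$. A $\mu$-Martin-Löf test is a uniformly $\Sigma^0_1$ sequence $(\mathcal U_i)_{i\in\omega}$ with $\mu(\mathcal U_i)\le 2^{-i}$; $X$ is $\mu$-Martin-Löf random if $X\notin\bigcap_i\mathcal U_i$ for every such test. $X\upharpoonright n$ denotes the initial segment of $X$ of length $n$. $\mathrm K$ is prefix-free Kolmogorov complexity (with respect to a fixed universal prefix-free machine). An order is a non-decreasing unbounded function $f:\omega\to\omega$ with $f(0)=0$. $X\in 2^\omega$ is complex if there is a computable order $f$ such that $\mathrm K(X\upharpoonright n)\ge f(n)$ for all $n$. *)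

theory Defs
  imports
    "HOL-Probability.Probability_Measure"
    "HOL-Library.Nat_Bijection"
    "HOL-Library.Sublist"
    "HOL-Library.Extended_Nat"
begin

section \<open>Partial recursive functions\<close>

definition prim_rec ::
    "(nat \<rightharpoonup> nat) \<Rightarrow> (nat \<rightharpoonup> nat) \<Rightarrow> nat \<Rightarrow> nat \<Rightarrow> nat option" where
  "prim_rec f g a n =
     rec_nat (f a) (\<lambda>k r. Option.bind r (\<lambda>v. g (prod_encode (a, prod_encode (k, v))))) n"

text \<open>
  The \<open>\<mu>\<close>-operator: the search for a zero diverges as soon as it meets an undefined value.
\<close>

definition minimize :: "(nat \<rightharpoonup> nat) \<Rightarrow> nat \<rightharpoonup> nat" where
  "minimize f a =
     (let P = (\<lambda>n. f (prod_encode (a, n)) = Some 0 \<and>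
                    (\<forall>m<n. \<exists>k. f (prod_encode (a, m)) = Some (Suc k)))
      in if \<exists>n. P n then Some (THE n. P n) else None)"

text \<open>
  Kleene's partial recursive functions in one variable, where several arguments are passed as one
  number by means of the Cantor pairing function \<^const>\<open>prod_encode\<close>. Pairing and its two
  projections take over the role of the projections of the many-variable presentation.
\<close>

inductive partial_recursive :: "(nat \<rightharpoonup> nat) \<Rightarrow> bool" where
  zero: "partial_recursive (\<lambda>_. Some 0)"
| succ: "partial_recursive (\<lambda>n. Some (Suc n))"
| left: "partial_recursive (\<lambda>n. Some (fst (prod_decode n)))"
| right: "partial_recursive (\<lambda>n. Some (snd (prod_decode n)))"
| pair: "partial_recursive f \<Longrightarrow> partial_recursive g \<Longrightarrow>
    partial_recursive
      (\<lambda>n. Option.bind (f n) (\<lambda>a. Option.bind (g n) (\<lambda>b. Some (prod_encode (a, b)))))"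
| comp: "partial_recursive f \<Longrightarrow> partial_recursive g \<Longrightarrow>
    partial_recursive (\<lambda>n. Option.bind (g n) f)"
| prec: "partial_recursive f \<Longrightarrow> partial_recursive g \<Longrightarrow>
    partial_recursive (\<lambda>n. prim_rec f g (fst (prod_decode n)) (snd (prod_decode n)))"
| mu: "partial_recursive f \<Longrightarrow> partial_recursive (minimize f)"

definition computable :: "(nat \<Rightarrow> nat) \<Rightarrow> bool" where
  "computable f \<longleftrightarrow> partial_recursive (\<lambda>n. Some (f n))"

definition ce_set :: "nat set \<Rightarrow> bool" where
  "ce_set A \<longleftrightarrow> (\<exists>f. partial_recursive f \<and> A = dom f)"

section \<open>Finite strings and Cantor space\<close>

text \<open>
  The position of a string in the length-lexicographic order of all binary strings; this is the
  usual identification of the set of finite binary strings with the natural numbers.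
\<close>

definition str_code :: "bool list \<Rightarrow> nat" where
  "str_code \<sigma> = foldl (\<lambda>n b. 2 * n + (if b then 2 else 1)) 0 \<sigma>"

lemma str_code_Nil [simp]: "str_code [] = 0"
  and str_code_snoc [simp]: "str_code (\<sigma> @ [b]) = 2 * str_code \<sigma> + (if b then 2 else 1)"
  by (simp_all add: str_code_def)

lemma bij_str_code: "bij str_code"
proof (rule bijI)
  show "inj str_code"
  proof (rule injI)
    fix \<sigma> \<tau> :: "bool list"
    assume "str_code \<sigma> = str_code \<tau>"
    then show "\<sigma> = \<tau>"
    proof (induction \<sigma> arbitrary: \<tau> rule: rev_induct)
      case Nil
      then show ?case by (cases \<tau> rule: rev_cases) (auto split: if_splits)
    next
      case (snoc b \<sigma>)
      show ?case
      proof (cases \<tau> rule: rev_cases)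
        case Nil
        with snoc.prems show ?thesis by (auto split: if_splits)
      next
        case (snoc \<tau>' c)
        have "b = c \<and> str_code \<sigma> = str_code \<tau>'"
          using snoc.prems snoc by (auto split: if_splits; presburger)
        with snoc snoc.IH show ?thesis by blast
      qed
    qed
  qed
  have "\<exists>\<sigma>. n = str_code \<sigma>" for n
  proof (induction n rule: less_induct)
    case (less n)
    show ?case
    proof (cases "n = 0")
      case True
      then show ?thesis by (metis str_code_Nil)
    next
      case False
      then have "(n - 1) div 2 < n" by linarith
      then obtain \<sigma> where "(n - 1) div 2 = str_code \<sigma>" using less by blast
      moreover from False have "n = 2 * ((n - 1) div 2) + (if even n then 2 else 1)"
        by (cases "even n") (simp_all, presburger+)
      ultimately have "n = str_code (\<sigma> @ [even n])" by simp
      then show ?thesis by blast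
    qed
  qed
  then show "surj str_code" by blast
qed

definition init_seg :: "(nat \<Rightarrow> bool) \<Rightarrow> nat \<Rightarrow> bool list" where
  "init_seg X n = map X [0..<n]"

definition cylinder :: "bool list \<Rightarrow> (nat \<Rightarrow> bool) set" where
  "cylinder \<sigma> = {X. init_seg X (length \<sigma>) = \<sigma>}"

section \<open>Computable and continuous measures\<close>

text \<open>
  The Borel sets of \<^typ>\<open>nat \<Rightarrow> bool\<close> are those of the product topology, with the discrete topology
  on \<^typ>\<open>bool\<close>.
\<close>

definition cantor_measure :: "(nat \<Rightarrow> bool) measure \<Rightarrow> bool" where
  "cantor_measure \<mu> \<longleftrightarrow> prob_space \<mu> \<and> sets \<mu> = sets borel"

text \<open>
  The approximation with index \<open>i\<close> at \<open>\<sigma>\<close> is the dyadic rational \<open>m / 2 ^ e\<close>, with \<open>m\<close> an integer,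
  coded by \<^const>\<open>int_decode\<close>.
\<close>

definition computable_real_function :: "(bool list \<Rightarrow> real) \<Rightarrow> bool" where
  "computable_real_function r \<longleftrightarrow>
     (\<exists>m e. computable m \<and> computable e \<and>
        (\<forall>\<sigma> i. let c = prod_encode (str_code \<sigma>, i)
               in \<bar>real_of_int (int_decode (m c)) / 2 ^ e c - r \<sigma>\<bar> \<le> (1 / 2) ^ i))"

definition computable_measure :: "(nat \<Rightarrow> bool) measure \<Rightarrow> bool" where
  "computable_measure \<mu> \<longleftrightarrow> computable_real_function (\<lambda>\<sigma>. measure \<mu> (cylinder \<sigma>))"

definition continuous_measure :: "(nat \<Rightarrow> bool) measure \<Rightarrow> bool" where
  "continuous_measure \<mu> \<longleftrightarrow> (\<forall>X. measure \<mu> {X} = 0)"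

section \<open>Randomness\<close>

definition uniformly_sigma01 :: "(nat \<Rightarrow> (nat \<Rightarrow> bool) set) \<Rightarrow> bool" where
  "uniformly_sigma01 U \<longleftrightarrow>
     (\<exists>W. ce_set W \<and> (\<forall>i. U i = (\<Union>\<sigma> \<in> {\<sigma>. prod_encode (i, str_code \<sigma>) \<in> W}. cylinder \<sigma>)))"

definition ml_test :: "(nat \<Rightarrow> bool) measure \<Rightarrow> (nat \<Rightarrow> (nat \<Rightarrow> bool) set) \<Rightarrow> bool" where
  "ml_test \<mu> U \<longleftrightarrow> uniformly_sigma01 U \<and> (\<forall>i. measure \<mu> (U i) \<le> (1 / 2) ^ i)"

definition ml_random :: "(nat \<Rightarrow> bool) measure \<Rightarrow> (nat \<Rightarrow> bool) \<Rightarrow> bool" where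
  "ml_random \<mu> X \<longleftrightarrow> (\<forall>U. ml_test \<mu> U \<longrightarrow> X \<notin> (\<Inter>i. U i))"

section \<open>Prefix-free complexity and complex sequences\<close>

definition partial_computable :: "(bool list \<rightharpoonup> bool list) \<Rightarrow> bool" where
  "partial_computable M \<longleftrightarrow>
     (\<exists>f. partial_recursive f \<and> (\<forall>\<sigma>. f (str_code \<sigma>) = map_option str_code (M \<sigma>)))"

definition prefix_free_machine :: "(bool list \<rightharpoonup> bool list) \<Rightarrow> bool" where
  "prefix_free_machine M \<longleftrightarrow>
     partial_computable M \<and> (\<forall>p \<in> dom M. \<forall>q \<in> dom M. prefix p q \<longrightarrow> p = q)"

text \<open>The value is \<open>\<infinity>\<close> if no program produces \<open>\<sigma>\<close>.\<close>

definition complexity :: "(bool list \<rightharpoonup> bool list) \<Rightarrow> bool list \<Rightarrow> enat" where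
  "complexity M \<sigma> = (INF p \<in> {p. M p = Some \<sigma>}. enat (length p))"

text \<open>
  Universality in the sense of additive optimality. A machine that simulates every prefix-free
  machine \<open>M\<close> on inputs prefixed by some string \<open>\<rho>\<close> depending on \<open>M\<close> is universal in this
  sense, with \<open>c\<close> the length of \<open>\<rho>\<close>.
\<close>

definition universal_prefix_free_machine :: "(bool list \<rightharpoonup> bool list) \<Rightarrow> bool" where
  "universal_prefix_free_machine U \<longleftrightarrow>
     prefix_free_machine U \<and>
     (\<forall>M. prefix_free_machine M \<longrightarrow> (\<exists>c. \<forall>\<sigma>. complexity U \<sigma> \<le> complexity M \<sigma> + enat c))"

definition order_function :: "(nat \<Rightarrow> nat) \<Rightarrow> bool" where
  "order_function f \<longleftrightarrow> mono f \<and> (\<forall>m. \<exists>n. m \<le> f n) \<and> f 0 = 0"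

text \<open>\<open>U\<close> is the machine that defines \<open>K\<close>.\<close>

definition complex_sequence :: "(bool list \<rightharpoonup> bool list) \<Rightarrow> (nat \<Rightarrow> bool) \<Rightarrow> bool" where
  "complex_sequence U X \<longleftrightarrow>
     (\<exists>f. order_function f \<and> computable f \<and> (\<forall>n. enat (f n) \<le> complexity U (init_seg X n)))"

end

theory Submission
  imports Defs
begin

text \<open>
  A machine has few programs, so its outputs are easy to cover unless they carry a lot of measure,
  and for a continuous measure long strings carry little, at a rate that can be computed.

  Number the programs by \<^const>\<open>str_code\<close>, and let \<open>V i\<close> be the union of the cylinders of all
  outputs \<open>\<sigma>\<close> of programs \<open>q \<ge> i\<close> for which \<open>\<mu> \<sigma> \<le> (1/2) ^ (q + 1)\<close>. Each program contributes at
  most one output, so \<open>\<mu> (V i)\<close> is at most the sum of \<open>(1/2) ^ (q + 1)\<close> over \<open>q \<ge> i\<close>, which is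
  \<open>(1/2) ^ i\<close> (\<open>measure_Union_outputs_le\<close>). An inequality between computable reals is not decidable,
  so it is replaced by a decidable test on an approximation, which still forces the bound and which
  is passed as soon as \<open>\<mu> \<sigma> \<le> (1/2) ^ (q + 2)\<close> (\<open>computable_threshold_test\<close>). Then \<open>V\<close> is a
  Martin-Loef test, and a random \<open>X\<close> lies outside some \<open>V i\<close>.

  By continuity of \<open>\<mu>\<close> only finitely many strings have measure above a given bound
  (\<open>ex_length_measure_cylinder_le\<close>), and since \<open>\<mu>\<close> is computable, a search finds a number \<open>g q\<close>
  such that all strings with code at least \<open>g q\<close> pass the test for \<open>q\<close>
  (\<open>computable_bounded_all_search\<close>). If a program \<open>q \<ge> i\<close> outputs the initial segment of \<open>X\<close> of
  length \<open>n\<close>, that segment fails the test, so its code, and hence \<open>n\<close>, is below \<open>g q\<close>. Thus \<open>q\<close> is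
  bounded below by a computable order of \<open>n\<close>, roughly the inverse of \<open>g\<close>, and the length of the
  program by its logarithm (\<open>ex_order_below\<close>). The finitely many programs below \<open>i\<close> output strings
  of bounded length, and shifting the order by that bound takes care of them.
\<close>

section \<open>Computable functions\<close>

lemma computable_const: "computable (\<lambda>_. c)"
proof (induction c)
  case 0
  show ?case by (simp add: computable_def partial_recursive.zero)
next
  case (Suc c)
  then show ?case
    using partial_recursive.comp[OF partial_recursive.succ] by (fastforce simp: computable_def)
qed

lemma computable_comp:
  assumes "computable f" "computable g"
  shows "computable (\<lambda>n. f (g n))"
  using partial_recursive.comp[OF assms[unfolded computable_def]] by (simp add: computable_def)

lemma computable_pair:
  assumes "computable f" "computable g"
  shows "computable (\<lambda>n. prod_encode (f n, g n))"
  using partial_recursive.pair[OF assms[unfolded computable_def]] by (simp add: computable_def)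

lemma computable_fst:
  assumes "computable f"
  shows "computable (\<lambda>n. fst (prod_decode (f n)))"
  by (rule computable_comp[OF _ assms]) (simp add: computable_def partial_recursive.left)

lemma computable_snd:
  assumes "computable f"
  shows "computable (\<lambda>n. snd (prod_decode (f n)))"
  by (rule computable_comp[OF _ assms]) (simp add: computable_def partial_recursive.right)

lemma computable_id: "computable (\<lambda>n. n)"
  using partial_recursive.pair[OF partial_recursive.left partial_recursive.right]
  by (simp add: computable_def)

lemma computable_Suc:
  assumes "computable f"
  shows "computable (\<lambda>n. Suc (f n))"
  by (rule computable_comp[OF _ assms]) (simp add: computable_def partial_recursive.succ)

text \<open>
  The step function is given in curried form, so that the rules for computability can be applied to
  its body. The same is done for minimization below.
\<close>

lemma computable_rec_nat:
  assumes f: "computable f"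
    and h: "computable (\<lambda>x. h (fst (prod_decode x)) (fst (prod_decode (snd (prod_decode x))))
                             (snd (prod_decode (snd (prod_decode x)))))"
    and j: "computable j"
  shows "computable (\<lambda>n. rec_nat (f n) (h n) (j n))"
proof -
  let ?h = "\<lambda>x. Some (h (fst (prod_decode x)) (fst (prod_decode (snd (prod_decode x))))
                             (snd (prod_decode (snd (prod_decode x)))))"
  have *: "prim_rec (\<lambda>n. Some (f n)) ?h a n = Some (rec_nat (f a) (h a) n)" for a n
    by (induction n) (simp_all add: prim_rec_def)
  have "computable (\<lambda>x. rec_nat (f (fst (prod_decode x))) (h (fst (prod_decode x))) (snd (prod_decode x)))"
    using partial_recursive.prec[OF f[unfolded computable_def] h[unfolded computable_def]]
    by (simp add: computable_def *)
  from computable_comp[OF this computable_pair[OF computable_id j]] show ?thesis by simp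
qed

lemma minimize_total:
  fixes F :: "nat \<Rightarrow> nat"
  assumes F: "\<And>n. F (prod_encode (a, n)) = P n" and ex: "\<exists>n. P n = 0"
  shows "minimize (\<lambda>x. Some (F x)) a = Some (LEAST n. P n = 0)"
proof -
  have least: "P (LEAST n. P n = 0) = 0" using ex by (rule LeastI_ex)
  have below: "\<exists>k. P m = Suc k" if "m < (LEAST n. P n = 0)" for m
    using not_less_Least[OF that] by (cases "P m") auto
  have "(THE n. P n = 0 \<and> (\<forall>m<n. \<exists>k. P m = Suc k)) = (LEAST n. P n = 0)"
  proof (rule the_equality)
    show "n = (LEAST n. P n = 0)" if "P n = 0 \<and> (\<forall>m<n. \<exists>k. P m = Suc k)" for n
      using that least below by (metis linorder_neqE_nat nat.distinct(1))
  qed (use least below in blast)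
  moreover have "\<exists>n. P n = 0 \<and> (\<forall>m<n. \<exists>k. P m = Suc k)" using least below by blast
  ultimately show ?thesis by (simp add: minimize_def F)
qed

lemma computable_Least:
  assumes P: "computable (\<lambda>x. P (fst (prod_decode x)) (snd (prod_decode x)))"
    and ex: "\<And>a. \<exists>n. P a n = (0::nat)"
    and j: "computable j"
  shows "computable (\<lambda>a. LEAST n. P (j a) n = 0)"
proof -
  have "minimize (\<lambda>x. Some (P (fst (prod_decode x)) (snd (prod_decode x)))) a
      = Some (LEAST n. P a n = 0)" for a
    by (rule minimize_total) (simp_all add: ex)
  then have "minimize (\<lambda>x. Some (P (fst (prod_decode x)) (snd (prod_decode x))))
      = (\<lambda>a. Some (LEAST n. P a n = 0))" by (rule ext)
  with partial_recursive.mu[OF P[unfolded computable_def]]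
  have "computable (\<lambda>a. LEAST n. P a n = 0)" by (simp only: computable_def)
  from computable_comp[OF this j] show ?thesis .
qed

lemmas computable_basics = computable_id computable_const computable_pair computable_fst
  computable_snd computable_Suc

lemma computable_add:
  assumes "computable f" "computable g"
  shows "computable (\<lambda>n. f n + g n)"
proof -
  have "rec_nat a (\<lambda>k v. Suc v) b = a + b" for a b by (induction b) auto
  moreover have "computable (\<lambda>n. rec_nat (f n) (\<lambda>k v. Suc v) (g n))"
    by (rule computable_rec_nat[where h = "\<lambda>n k v. Suc v"]) (intro computable_basics assms)+
  ultimately show ?thesis by simp
qed

lemma computable_mult:
  assumes "computable f" "computable g"
  shows "computable (\<lambda>n. f n * g n)"
proof -
  have "rec_nat 0 (\<lambda>k v. v + a) b = a * b" for a b by (induction b) auto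
  moreover have "computable (\<lambda>n. rec_nat 0 (\<lambda>k v. v + f n) (g n))"
    by (rule computable_rec_nat[where h = "\<lambda>n k v. v + f n"])
      (intro computable_basics computable_add computable_comp[OF assms(1)] assms)+
  ultimately show ?thesis by simp
qed

lemma computable_power2:
  assumes "computable f"
  shows "computable (\<lambda>n. 2 ^ f n)"
proof -
  have "rec_nat (Suc 0) (\<lambda>k v. 2 * v) b = (2 :: nat) ^ b" for b by (induction b) auto
  moreover have "computable (\<lambda>n. rec_nat (Suc 0) (\<lambda>k v. 2 * v) (f n))"
    by (rule computable_rec_nat[where h = "\<lambda>n k v. 2 * v"])
      (intro computable_basics computable_mult assms)+
  ultimately show ?thesis by simp
qed

lemma computable_diff:
  assumes "computable f" "computable g"
  shows "computable (\<lambda>n. f n - g n)"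
proof -
  have pred: "computable (\<lambda>n. n - 1)"
  proof -
    have "rec_nat 0 (\<lambda>k v. k) b = b - 1" for b :: nat by (induction b) auto
    moreover have "computable (\<lambda>n. rec_nat 0 (\<lambda>k v. k) n)"
      by (rule computable_rec_nat[where h = "\<lambda>n k v. k"]) (intro computable_basics)+
    ultimately show ?thesis by simp
  qed
  have "rec_nat a (\<lambda>k v. v - 1) b = a - b" for a b :: nat by (induction b) auto
  moreover have "computable (\<lambda>n. rec_nat (f n) (\<lambda>k v. v - 1) (g n))"
    by (rule computable_rec_nat[where h = "\<lambda>n k v. v - 1"])
      (intro computable_basics computable_comp[OF pred] assms)+
  ultimately show ?thesis by simp
qed

lemma computable_half:
  assumes "computable f"
  shows "computable (\<lambda>n. f n div 2)"
proof -
  have "(LEAST k. m - Suc (2 * k) = 0) = m div 2" for m :: nat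
    by (rule Least_equality) auto
  moreover have "computable (\<lambda>n. LEAST k. f n - Suc (2 * k) = 0)"
  proof (rule computable_Least[where P = "\<lambda>m k. m - Suc (2 * k)"])
    show "\<exists>k. m - Suc (2 * k) = 0" for m :: nat by (rule exI[of _ m]) simp
  qed (intro computable_basics computable_mult computable_diff assms)+
  ultimately show ?thesis by simp
qed

lemmas computable_arith = computable_basics computable_add computable_mult computable_power2
  computable_diff computable_half

lemma computable_funpow:
  assumes "computable h" "computable f" "computable g"
  shows "computable (\<lambda>n. (h ^^ f n) (g n))"
proof -
  have "rec_nat a (\<lambda>k v. h v) b = (h ^^ b) a" for a b by (induction b) auto
  moreover have "computable (\<lambda>n. rec_nat (g n) (\<lambda>k v. h v) (f n))"
    by (rule computable_rec_nat[where h = "\<lambda>n k v. h v"])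
      (intro computable_basics computable_comp[OF assms(1)] assms)+
  ultimately show ?thesis by simp
qed

section \<open>Strings and their codes\<close>

text \<open>
  The last bit of a nonempty string is removed by one arithmetic operation on codes; the code 0 of
  the empty string is a fixed point because subtraction on \<^typ>\<open>nat\<close> truncates. Iterating this
  operation yields both the length of a string and its initial segments.
\<close>

definition parent :: "nat \<Rightarrow> nat" where
  "parent s = (s - 1) div 2"

definition code_length :: "nat \<Rightarrow> nat" where
  "code_length s = (LEAST k. (parent ^^ k) s = 0)"

lemma parent_str_code: "parent (str_code \<sigma>) = str_code (butlast \<sigma>)"
  by (cases \<sigma> rule: rev_cases) (auto simp: parent_def)

lemma funpow_parent_str_code: "(parent ^^ k) (str_code \<sigma>) = str_code (take (length \<sigma> - k) \<sigma>)"
proof (induction k)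
  case (Suc k)
  then show ?case by (simp add: parent_str_code butlast_take)
qed simp

lemma str_code_eq_iff: "str_code \<sigma> = str_code \<tau> \<longleftrightarrow> \<sigma> = \<tau>"
  using bij_str_code by (simp add: bij_def inj_eq)

lemma str_code_eq_0_iff: "str_code \<sigma> = 0 \<longleftrightarrow> \<sigma> = []"
  using str_code_eq_iff[of \<sigma> "[]"] by simp

lemma code_length_str_code: "code_length (str_code \<sigma>) = length \<sigma>"
proof -
  have "(parent ^^ k) (str_code \<sigma>) = 0 \<longleftrightarrow> length \<sigma> \<le> k" for k
    by (auto simp: funpow_parent_str_code str_code_eq_0_iff)
  then show ?thesis unfolding code_length_def by (simp add: Least_equality)
qed

lemma obtain_str_code: obtains \<sigma> where "n = str_code \<sigma>"
  by (rule surjE[OF bij_is_surj[OF bij_str_code], of n])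

lemma mono_funpow_parent: "mono (parent ^^ k)"
proof (induction k)
  case (Suc k)
  have "mono parent" by (simp add: mono_def parent_def div_le_mono diff_le_mono)
  with Suc show ?case by (simp add: mono_def)
qed (simp add: mono_def)

text \<open>
  Codes follow the length-lexicographic order. On codes this is visible because
  \<^const>\<open>parent\<close> is monotone, so a smaller number reaches 0 no later.
\<close>

lemma code_length_mono:
  assumes "s \<le> t"
  shows "code_length s \<le> code_length t"
proof -
  obtain \<tau> where "t = str_code \<tau>" by (rule obtain_str_code)
  then have "(parent ^^ length \<tau>) t = 0" by (simp add: funpow_parent_str_code)
  then have "(parent ^^ code_length t) t = 0"
    unfolding code_length_def by (rule LeastI[of "\<lambda>k. (parent ^^ k) t = 0"])
  then have "(parent ^^ code_length t) s = 0"
    using monoD[OF mono_funpow_parent assms, of "code_length t"] by simp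
  then show ?thesis
    unfolding code_length_def[of s] by (rule Least_le[of "\<lambda>k. (parent ^^ k) s = 0"])
qed

lemma computable_parent: "computable parent"
  unfolding parent_def[abs_def] by (intro computable_arith)

lemma computable_code_length:
  assumes "computable f"
  shows "computable (\<lambda>n. code_length (f n))"
  unfolding code_length_def
proof (rule computable_Least[where P = "\<lambda>s k. (parent ^^ k) s"])
  fix s
  obtain \<sigma> where "s = str_code \<sigma>" by (rule obtain_str_code)
  then have "(parent ^^ length \<sigma>) s = 0" by (simp add: funpow_parent_str_code)
  then show "\<exists>k. (parent ^^ k) s = 0" ..
qed (intro computable_funpow computable_parent computable_arith assms)+

lemma length_le_str_code: "length \<sigma> \<le> str_code \<sigma>"
  by (induction \<sigma> rule: rev_induct) auto

text \<open>
  Removing a bit roughly halves the code, so on the way from \<open>\<sigma>\<close> down to the empty string the codes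
  cannot jump over the interval from \<open>b\<close> to \<open>2 * b\<close>. Measure decreases along extensions, so an upper
  bound on measures that holds on this finite interval holds for every string with code at least \<open>b\<close>.
\<close>

lemma ex_prefix_str_code_between:
  assumes "b \<le> str_code \<sigma>"
  shows "\<exists>\<rho>. prefix \<rho> \<sigma> \<and> b \<le> str_code \<rho> \<and> str_code \<rho> \<le> 2 * b"
  using assms
proof (induction \<sigma> rule: rev_induct)
  case (snoc c \<sigma>)
  show ?case
  proof (cases "str_code (\<sigma> @ [c]) \<le> 2 * b")
    case True
    with snoc.prems show ?thesis by blast
  next
    case False
    then have "b \<le> str_code \<sigma>" by (auto split: if_splits)
    with snoc.IH show ?thesis by (metis prefix_snoc)
  qed
next
  case Nil
  then show ?case by (intro exI[of _ "[]"]) simp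
qed

section \<open>Cylinders\<close>

lemma length_init_seg [simp]: "length (init_seg X n) = n"
  by (simp add: init_seg_def)

lemma mem_cylinder_iff: "X \<in> cylinder \<sigma> \<longleftrightarrow> (\<forall>i<length \<sigma>. X i = \<sigma> ! i)"
  unfolding cylinder_def init_seg_def mem_Collect_eq by (subst list_eq_iff_nth_eq) simp

lemma mem_cylinder_init_seg: "X \<in> cylinder (init_seg X n)"
  by (simp add: cylinder_def init_seg_def)

lemma cylinder_antimono:
  assumes "prefix \<rho> \<sigma>"
  shows "cylinder \<sigma> \<subseteq> cylinder \<rho>"
  using assms by (auto simp: mem_cylinder_iff prefix_def nth_append)

lemma prefix_init_seg:
  assumes "X \<in> cylinder \<sigma>" "length \<sigma> \<le> n"
  shows "take (length \<sigma>) (init_seg X n) = \<sigma>"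
  using assms by (intro nth_equalityI) (auto simp: mem_cylinder_iff init_seg_def)

lemma cylinder_borel: "cylinder \<sigma> \<in> sets borel"
proof -
  have "{X :: nat \<Rightarrow> bool. X i = b} \<in> sets borel" for i b
  proof -
    have "(\<lambda>X. X i) \<in> borel_measurable (borel :: (nat \<Rightarrow> bool) measure)"
      by (rule borel_measurable_continuous_onI, rule continuous_on_product_coordinates)
    from measurable_sets[OF this, of "{b}"] show ?thesis by (simp add: vimage_def)
  qed
  then have "(\<Inter>i<length \<sigma>. {X. X i = \<sigma> ! i}) \<in> sets borel"
    by (intro sets.countable_INT'' borel_open[OF open_UNIV]) auto
  also have "(\<Inter>i\<in>{..<length \<sigma>}. {X. X i = \<sigma> ! i}) = cylinder \<sigma>"
    by (auto simp: mem_cylinder_iff)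
  finally show ?thesis .
qed

lemma sets_cylinder:
  assumes "cantor_measure \<mu>"
  shows "cylinder \<sigma> \<in> sets \<mu>"
  using assms cylinder_borel by (simp add: cantor_measure_def)

lemma measure_cylinder_mono:
  assumes "cantor_measure \<mu>" "prefix \<rho> \<sigma>"
  shows "measure \<mu> (cylinder \<sigma>) \<le> measure \<mu> (cylinder \<rho>)"
proof -
  interpret prob_space \<mu> using assms by (simp add: cantor_measure_def)
  show ?thesis using finite_measure_mono cylinder_antimono sets_cylinder assms by metis
qed

lemma prefix_init_seg_Suc: "prefix (init_seg X n) (init_seg X (Suc n))"
  by (simp add: init_seg_def)

text \<open>
  The sequences whose initial segment of length \<open>n\<close> has measure above \<open>\<epsilon>\<close> form a decreasing sequence
  of sets. If none of them is empty, each has measure above \<open>\<epsilon>\<close>, hence their intersection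
  has measure at least \<open>\<epsilon>\<close> and contains some \<open>X\<close>; then all neighbourhoods of \<open>X\<close> have measure
  above \<open>\<epsilon>\<close>, and \<open>X\<close> is an atom. Continuity from above thus replaces a compactness argument.
\<close>

lemma ex_length_measure_cylinder_le:
  assumes \<mu>: "cantor_measure \<mu>" "continuous_measure \<mu>" and "\<epsilon> > 0"
  shows "\<exists>n. \<forall>X. measure \<mu> (cylinder (init_seg X n)) \<le> \<epsilon>"
proof (rule ccontr)
  assume "\<not> ?thesis"
  then have heavy: "\<exists>X. measure \<mu> (cylinder (init_seg X n)) > \<epsilon>" for n by (metis not_le)
  interpret prob_space \<mu> using \<mu> by (simp add: cantor_measure_def)
  define E where "E n = {X. measure \<mu> (cylinder (init_seg X n)) > \<epsilon>}" for n
  have E_eq: "E n = (\<Union>\<sigma>\<in>{\<sigma>. length \<sigma> = n \<and> measure \<mu> (cylinder \<sigma>) > \<epsilon>}. cylinder \<sigma>)" for n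
  proof (intro set_eqI iffI)
    fix X assume "X \<in> E n"
    then show "X \<in> (\<Union>\<sigma>\<in>{\<sigma>. length \<sigma> = n \<and> measure \<mu> (cylinder \<sigma>) > \<epsilon>}. cylinder \<sigma>)"
      using mem_cylinder_init_seg[of X n] by (force simp: E_def init_seg_def)
  next
    fix X assume "X \<in> (\<Union>\<sigma>\<in>{\<sigma>. length \<sigma> = n \<and> measure \<mu> (cylinder \<sigma>) > \<epsilon>}. cylinder \<sigma>)"
    then show "X \<in> E n" by (auto simp: E_def cylinder_def)
  qed
  have E_sets: "E n \<in> sets \<mu>" for n
    unfolding E_eq by (rule sets.countable_UN'') (auto intro: sets_cylinder \<mu>)
  have "decseq E"
    using measure_cylinder_mono[OF \<mu>(1) prefix_init_seg_Suc]
    by (intro decseq_SucI) (force simp: E_def intro: less_le_trans)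
  then have "(\<lambda>n. measure \<mu> (E n)) \<longlonglongrightarrow> measure \<mu> (\<Inter>n. E n)"
    using E_sets by (intro finite_Lim_measure_decseq) auto
  moreover have "\<epsilon> \<le> measure \<mu> (E n)" for n
  proof -
    obtain X where X: "measure \<mu> (cylinder (init_seg X n)) > \<epsilon>" using heavy by blast
    then have "cylinder (init_seg X n) \<subseteq> E n" by (auto simp: E_def cylinder_def init_seg_def)
    with X show ?thesis using finite_measure_mono E_sets by (meson less_le_trans less_imp_le)
  qed
  ultimately have "\<epsilon> \<le> measure \<mu> (\<Inter>n. E n)" by (intro LIMSEQ_le_const) auto
  with \<open>\<epsilon> > 0\<close> have "(\<Inter>n. E n) \<noteq> {}" by (metis measure_empty not_le)
  then obtain X where X: "\<And>n. measure \<mu> (cylinder (init_seg X n)) > \<epsilon>" by (auto simp: E_def)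
  have "(\<Inter>n. cylinder (init_seg X n)) = {X}"
  proof (intro equalityI subsetI)
    fix Y assume "Y \<in> (\<Inter>n. cylinder (init_seg X n))"
    then have "Y \<in> cylinder (init_seg X (Suc i))" for i by blast
    then have "Y i = X i" for i by (auto simp: mem_cylinder_iff init_seg_def simp del: upt_Suc)
    then show "Y \<in> {X}" by auto
  qed (auto simp: mem_cylinder_init_seg)
  moreover have "(\<lambda>n. measure \<mu> (cylinder (init_seg X n))) \<longlonglongrightarrow> measure \<mu> (\<Inter>n. cylinder (init_seg X n))"
    using sets_cylinder[OF \<mu>(1)] cylinder_antimono[OF prefix_init_seg_Suc]
    by (intro finite_Lim_measure_decseq decseq_SucI) auto
  ultimately have "\<epsilon> \<le> measure \<mu> {X}" using X by (intro LIMSEQ_le_const) (auto intro!: exI[of _ 0] less_imp_le)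
  with \<mu>(2) \<open>\<epsilon> > 0\<close> show False by (simp add: continuous_measure_def)
qed

section \<open>Deciding and searching with approximations\<close>

text \<open>
  With an approximation \<open>a\<close> of precision \<open>(1/2) ^ (q + 3)\<close>, the test accepts if \<open>a\<close> is at most three
  times the precision. Then \<open>r \<sigma>\<close> is at most four times the precision, and conversely \<open>\<sigma>\<close> is accepted
  if \<open>r \<sigma>\<close> is at most twice the precision. Decidable predicates are represented by the zeros of
  computable functions, the form that minimization requires.
\<close>

lemma computable_threshold_test:
  assumes "computable_real_function r"
  obtains t where "computable t"
    and "\<And>\<sigma> q. t (prod_encode (str_code \<sigma>, q)) = 0 \<Longrightarrow> r \<sigma> \<le> (1 / 2) ^ (q + 1)"
    and "\<And>\<sigma> q. r \<sigma> \<le> (1 / 2) ^ (q + 2) \<Longrightarrow> t (prod_encode (str_code \<sigma>, q)) = 0"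
proof -
  obtain m e where me: "computable m" "computable e"
    and approx: "\<And>\<sigma> i. \<bar>real_of_int (int_decode (m (prod_encode (str_code \<sigma>, i))))
        / 2 ^ e (prod_encode (str_code \<sigma>, i)) - r \<sigma>\<bar> \<le> (1 / 2) ^ i"
    using assms by (auto simp: computable_real_function_def Let_def)
  \<comment> \<open>A negative approximation always passes and may be replaced by 0, so that the comparison
    takes place in \<^typ>\<open>nat\<close>; an even code stands for a nonnegative integer.\<close>
  define pos where "pos n = (n div 2) * (1 - (n - 2 * (n div 2)))" for n :: nat
  have pos: "int (pos n) = max 0 (int_decode n)" for n
    by (cases "even n") (auto simp: pos_def int_decode_def sum_decode_def elim!: evenE oddE)
  define c where "c x = prod_encode (fst (prod_decode x), snd (prod_decode x) + 3)" for x
  define t where "t x = pos (m (c x)) * 2 ^ (snd (prod_decode x) + 3) - 3 * 2 ^ e (c x)" for x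
  have "computable t"
    unfolding t_def[abs_def] pos_def c_def
    by (intro computable_arith computable_comp[OF me(1)] computable_comp[OF me(2)])
  moreover have t_iff: "t (prod_encode (str_code \<sigma>, q)) = 0 \<longleftrightarrow>
      real_of_int (int_decode (m (prod_encode (str_code \<sigma>, q + 3))))
        / 2 ^ e (prod_encode (str_code \<sigma>, q + 3)) \<le> 3 * (1 / 2) ^ (q + 3)" for \<sigma> q
  proof -
    let ?z = "int_decode (m (prod_encode (str_code \<sigma>, q + 3)))"
    let ?e = "e (prod_encode (str_code \<sigma>, q + 3))"
    have "t (prod_encode (str_code \<sigma>, q)) = 0 \<longleftrightarrow>
        int (pos (m (prod_encode (str_code \<sigma>, q + 3))) * 2 ^ (q + 3)) \<le> int (3 * 2 ^ ?e)"
      by (simp only: t_def c_def prod_encode_inverse fst_conv snd_conv diff_is_0_eq of_nat_le_iff)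
    also have "\<dots> \<longleftrightarrow> max 0 ?z * 2 ^ (q + 3) \<le> 3 * 2 ^ ?e"
      by (simp only: of_nat_mult pos of_nat_power of_nat_numeral)
    also have "\<dots> \<longleftrightarrow> ?z * 2 ^ (q + 3) \<le> 3 * 2 ^ ?e"
    proof (cases "?z \<le> 0")
      case True
      then have "?z * 2 ^ (q + 3) \<le> 0" by (intro mult_nonpos_nonneg) auto
      also have "(0::int) \<le> 3 * 2 ^ ?e" by simp
      finally show ?thesis using True by simp
    qed simp
    also have "\<dots> \<longleftrightarrow> real_of_int ?z * 2 ^ (q + 3) \<le> 3 * 2 ^ ?e"
      by (metis (mono_tags, opaque_lifting) of_int_le_iff of_int_mult of_int_numeral of_int_power)
    also have "\<dots> \<longleftrightarrow> real_of_int ?z / 2 ^ ?e \<le> 3 * (1 / 2) ^ (q + 3)"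
      by (simp add: field_simps power_one_over)
    finally show ?thesis .
  qed
  have pow: "(1 / 2) ^ (q + 1) = 4 * (1 / 2 :: real) ^ (q + 3)"
    "(1 / 2) ^ (q + 2) = 2 * (1 / 2 :: real) ^ (q + 3)" for q
    by (simp_all add: eval_nat_numeral)
  have "r \<sigma> \<le> (1 / 2) ^ (q + 1)" if "t (prod_encode (str_code \<sigma>, q)) = 0" for \<sigma> q
    using that[unfolded t_iff] approx[of \<sigma> "q + 3"] unfolding abs_le_iff pow by linarith
  moreover have "t (prod_encode (str_code \<sigma>, q)) = 0" if "r \<sigma> \<le> (1 / 2) ^ (q + 2)" for \<sigma> q
    using that approx[of \<sigma> "q + 3"] unfolding t_iff abs_le_iff pow by linarith
  ultimately show thesis using that by blast
qed

text \<open>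
  Bounded universal quantification is expressed by minimization: all \<open>s\<close> between \<open>b\<close> and \<open>2 * b\<close> are
  zeros if and only if the search for a failure at \<open>b + k\<close>, which stops at \<open>k = b + 1\<close> at the latest,
  runs up to that limit.
\<close>

lemma computable_bounded_all_search:
  assumes t: "computable t" and ex: "\<And>q. \<exists>b. \<forall>s\<ge>b. t (prod_encode (s, q)) = 0"
  obtains g where "computable g"
    and "\<And>q s. g q \<le> s \<Longrightarrow> s \<le> 2 * g q \<Longrightarrow> t (prod_encode (s, q)) = 0"
proof -
  define fails where "fails q b k = (1 - t (prod_encode (b + k, q))) * (Suc b - k)" for q b k
  define first where "first q b = (LEAST k. fails q b k = 0)" for q b
  define g where "g q = (LEAST b. Suc b - first q b = 0)" for q
  have fails_eq0: "fails q b k = 0 \<longleftrightarrow> b < k \<or> t (prod_encode (b + k, q)) \<noteq> 0" for q b k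
    by (auto simp: fails_def)
  have first_gt: "b < first q b \<longleftrightarrow> (\<forall>k\<le>b. t (prod_encode (b + k, q)) = 0)" for q b
  proof -
    have "fails q b (Suc b) = 0" by (simp add: fails_eq0)
    then have "fails q b (first q b) = 0"
      unfolding first_def by (rule LeastI[of "\<lambda>k. fails q b k = 0"])
    then have "\<exists>k\<le>b. t (prod_encode (b + k, q)) \<noteq> 0" if "first q b \<le> b"
      using that by (auto simp: fails_eq0)
    moreover have "first q b \<le> k" if "t (prod_encode (b + k, q)) \<noteq> 0" for k
      unfolding first_def by (rule Least_le[of "\<lambda>k. fails q b k = 0"]) (simp add: fails_eq0 that)
    ultimately show ?thesis by (meson le_less_trans not_le)
  qed
  have ex_first: "\<exists>b. Suc b - first q b = 0" for q
  proof -
    obtain b where "\<forall>s\<ge>b. t (prod_encode (s, q)) = 0" using ex by blast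
    then have "b < first q b" by (simp add: first_gt)
    then show ?thesis by (intro exI[of _ b]) simp
  qed
  have "Suc (g q) - first q (g q) = 0" for q
    unfolding g_def by (rule LeastI_ex[OF ex_first])
  then have g: "\<forall>k\<le>g q. t (prod_encode (g q + k, q)) = 0" for q
    by (simp add: first_gt[symmetric] Suc_le_eq)
  have first: "computable (\<lambda>x. first (fst (prod_decode x)) (snd (prod_decode x)))"
    unfolding first_def
  proof (rule computable_Least[where P = "\<lambda>x. fails (fst (prod_decode x)) (snd (prod_decode x))"])
    fix x
    show "\<exists>k. fails (fst (prod_decode x)) (snd (prod_decode x)) k = 0"
      by (rule exI[of _ "Suc (snd (prod_decode x))"]) (simp add: fails_eq0)
  qed (unfold fails_def, (intro computable_arith computable_comp[OF t])+)
  have "computable g"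
    unfolding g_def[abs_def]
    by (rule computable_Least[where P = "\<lambda>q b. Suc b - first q b"])
      (intro computable_arith first, rule ex_first, intro computable_arith)
  moreover have "t (prod_encode (s, q)) = 0" if "g q \<le> s" "s \<le> 2 * g q" for q s
    using g[of q] that by (metis add_le_cancel_left le_add_diff_inverse mult_2)
  ultimately show thesis using that by blast
qed

text \<open>
  The least \<open>q\<close> with \<open>n < g q\<close> would be an inverse of \<open>g\<close>, but it need not exist; admitting
  \<open>n \<le> q\<close> makes the search total. The result is monotone in \<open>n\<close>, because the condition becomes stronger as
  \<open>n\<close> grows. Passing from \<open>q\<close> to the length of the string with code \<open>q\<close> turns
  a bound on program numbers into one on program lengths.
\<close>

lemma ex_order_below:
  assumes g: "computable g"
  obtains f where "order_function f" "computable f" and "\<And>n q. n < g q \<Longrightarrow> f n \<le> code_length q"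
proof -
  define P where "P n q = (n - q) * (Suc n - g q)" for n q
  define f where "f n = (LEAST q. P n q = 0)" for n
  have P: "P n q = 0 \<longleftrightarrow> n \<le> q \<or> n < g q" for n q by (auto simp: P_def)
  have "P n n = 0" for n by (simp add: P)
  then have fP: "P n (f n) = 0" for n
    unfolding f_def by (rule LeastI[of "\<lambda>q. P n q = 0"])
  have f_le: "f n \<le> q" if "n \<le> q \<or> n < g q" for n q
    unfolding f_def by (rule Least_le[of "\<lambda>q. P n q = 0"]) (use that P in blast)
  have f_mono: "f m \<le> f n" if "m \<le> n" for m n
    using fP[of n] that by (intro f_le) (auto simp: P)
  have f_unbounded: "\<exists>n. m \<le> f n" for m
  proof -
    define n where "n = m + (\<Sum>q<m. g q)"
    have "q < n \<and> g q \<le> n" if "q < m" for q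
      using that member_le_sum[of q "{..<m}" g] by (simp add: n_def trans_le_add2)
    then have "m \<le> f n" using fP[of n] unfolding P by (meson not_le)
    then show ?thesis ..
  qed
  have "order_function (\<lambda>n. code_length (f n))"
    unfolding order_function_def
  proof (intro conjI allI)
    show "mono (\<lambda>n. code_length (f n))" by (intro monoI code_length_mono f_mono)
    fix m
    obtain n where "str_code (replicate m True) \<le> f n" using f_unbounded by blast
    from code_length_mono[OF this] have "m \<le> code_length (f n)" by (simp add: code_length_str_code)
    then show "\<exists>n. m \<le> code_length (f n)" ..
    have "f 0 = 0" using f_le[of 0 0] by simp
    then show "code_length (f 0) = 0" using code_length_str_code[of "[]"] by simp
  qed
  moreover have "computable f"
    unfolding f_def[abs_def]
  proof (rule computable_Least[where P = P])
    show "\<exists>q. P n q = 0" for n using fP by blast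
  qed (unfold P_def, (intro computable_arith computable_comp[OF g])+)
  then have "computable (\<lambda>n. code_length (f n))" by (rule computable_code_length)
  moreover have "code_length (f n) \<le> code_length q" if "n < g q" for n q
    using that by (intro code_length_mono f_le) simp
  ultimately show thesis using that by blast
qed

section \<open>The Martin-Loef test of light outputs\<close>

text \<open>
  Enumerating the outputs of \<open>f\<close> seems to call for running all programs in parallel. This is avoided
  by enumerating longer strings: the cylinder of an output \<open>\<sigma>\<close> of \<open>q\<close> is also the union of the
  cylinders of its extensions of any one length, and a sufficiently large length can be chosen that
  encodes \<open>q\<close>. So
  whether \<open>\<tau>\<close> is enumerated depends on a single program, the one named by the length of \<open>\<tau>\<close>: it is
  run, and then an initial segment of \<open>\<tau>\<close> that equals its output is searched for.
\<close>

lemma uniformly_sigma01_machine_outputs: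
  assumes f: "partial_recursive f" and t: "computable t"
  shows "uniformly_sigma01
    (\<lambda>i. \<Union>{cylinder \<sigma> | \<sigma> q. i \<le> q \<and> f q = Some (str_code \<sigma>) \<and> t (prod_encode (str_code \<sigma>, q)) = 0})"
proof -
  define query where "query x = fst (prod_decode (code_length (snd (prod_decode x))))" for x
  \<comment> \<open>\<open>H\<close> vanishes if and only if removing \<open>k\<close> bits from the given string leaves \<open>s\<close>, the program is
    at least \<open>i\<close>, and the test is passed; the first two summands form the distance of two numbers.\<close>
  define H where "H x k s = ((parent ^^ k) (snd (prod_decode x)) - s) + (s - (parent ^^ k) (snd (prod_decode x)))
      + (fst (prod_decode x) - query x) + t (prod_encode (s, query x))" for x k s
  define F where "F y = Option.bind (f (query (fst (prod_decode y))))
      (\<lambda>s. Some (H (fst (prod_decode y)) (snd (prod_decode y)) s))" for y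
  have F_pr: "partial_recursive F"
  proof -
    have query: "computable (\<lambda>y. query (fst (prod_decode y)))"
      unfolding query_def by (intro computable_code_length computable_arith)
    have "partial_recursive (\<lambda>y. f (query (fst (prod_decode y))))"
      using partial_recursive.comp[OF f query[unfolded computable_def]] by simp
    from partial_recursive.pair[OF computable_id[unfolded computable_def] this]
    have 1: "partial_recursive (\<lambda>y. Option.bind (f (query (fst (prod_decode y))))
        (\<lambda>s. Some (prod_encode (y, s))))" by simp
    have "computable (\<lambda>z. H (fst (prod_decode (fst (prod_decode z)))) (snd (prod_decode (fst (prod_decode z))))
        (snd (prod_decode z)))"
      unfolding H_def query_def
      by (intro computable_code_length computable_arith computable_funpow computable_parent
          computable_comp[OF t])
    from partial_recursive.comp[OF this[unfolded computable_def] 1]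
    show ?thesis unfolding F_def[abs_def]
      by simp
  qed
  define W where "W = dom (minimize F)"
  have W: "x \<in> W \<longleftrightarrow> (\<exists>s k. f (query x) = Some s \<and> H x k s = 0)" for x
  proof (cases "f (query x)")
    case None
    then show ?thesis by (auto simp: W_def minimize_def F_def)
  next
    case (Some s)
    have "x \<in> W \<longleftrightarrow> (\<exists>k. H x k s = 0 \<and> (\<forall>m<k. \<exists>j. H x m s = Suc j))"
      by (auto simp: W_def minimize_def F_def Some Let_def split: if_splits)
    also have "\<dots> \<longleftrightarrow> (\<exists>k. H x k s = 0)"
      using exists_least_iff[of "\<lambda>k. H x k s = 0"] by (metis not0_implies_Suc nat.distinct(1))
    finally show ?thesis using Some by auto
  qed
  have H: "H (prod_encode (i, str_code \<tau>)) k s = 0 \<longleftrightarrow>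
      str_code (take (length \<tau> - k) \<tau>) = s \<and> i \<le> fst (prod_decode (length \<tau>))
      \<and> t (prod_encode (s, fst (prod_decode (length \<tau>)))) = 0" for i \<tau> k s
    by (auto simp: H_def query_def funpow_parent_str_code code_length_str_code)
  have memW: "prod_encode (i, str_code \<tau>) \<in> W \<longleftrightarrow> (\<exists>\<sigma> k. \<sigma> = take (length \<tau> - k) \<tau> \<and>
      i \<le> fst (prod_decode (length \<tau>)) \<and> f (fst (prod_decode (length \<tau>))) = Some (str_code \<sigma>) \<and>
      t (prod_encode (str_code \<sigma>, fst (prod_decode (length \<tau>)))) = 0)" for i \<tau>
    unfolding W H by (auto simp: query_def code_length_str_code)
  have "ce_set W" using partial_recursive.mu[OF F_pr] by (auto simp: ce_set_def W_def)
  moreover have "\<Union>{cylinder \<sigma> | \<sigma> q. i \<le> q \<and> f q = Some (str_code \<sigma>) \<and> t (prod_encode (str_code \<sigma>, q)) = 0}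
      = (\<Union>\<tau>\<in>{\<tau>. prod_encode (i, str_code \<tau>) \<in> W}. cylinder \<tau>)" (is "?L = ?R") for i
  proof (intro equalityI subsetI)
    fix X assume "X \<in> ?L"
    then obtain \<sigma> q where \<sigma>: "X \<in> cylinder \<sigma>" "i \<le> q" "f q = Some (str_code \<sigma>)"
      "t (prod_encode (str_code \<sigma>, q)) = 0" by blast
    \<comment> \<open>The second component only makes the length at least that of \<open>\<sigma>\<close>.\<close>
    define n where "n = prod_encode (q, length \<sigma>)"
    have n: "length \<sigma> \<le> n" unfolding n_def by (rule le_prod_encode_2)
    have "\<sigma> = take (length (init_seg X n) - (n - length \<sigma>)) (init_seg X n)"
      by (simp only: length_init_seg diff_diff_cancel[OF n] prefix_init_seg[OF \<sigma>(1) n])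
    moreover have "fst (prod_decode (length (init_seg X n))) = q" by (simp add: n_def)
    ultimately have "prod_encode (i, str_code (init_seg X n)) \<in> W"
      unfolding memW using \<sigma>(2-4) by (intro exI[of _ \<sigma>] exI[of _ "n - length \<sigma>"]) simp
    then show "X \<in> ?R" using mem_cylinder_init_seg by blast
  next
    fix X assume "X \<in> ?R"
    then obtain \<tau> where \<tau>: "prod_encode (i, str_code \<tau>) \<in> W" "X \<in> cylinder \<tau>" by blast
    from \<tau>(1) show "X \<in> ?L"
      unfolding memW using \<tau>(2) cylinder_antimono[OF take_is_prefix] by blast
  qed
  ultimately show ?thesis unfolding uniformly_sigma01_def by blast
qed

text \<open>
  As \<open>f\<close> is single-valued, the part of the union that belongs to a fixed \<open>q\<close> is one cylinder or
  empty, and the bounds form a geometric series.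
\<close>

lemma measure_Union_outputs_le:
  fixes f :: "nat \<rightharpoonup> nat"
  assumes \<mu>: "cantor_measure \<mu>"
    and small: "\<And>\<sigma> q. P \<sigma> q \<Longrightarrow> measure \<mu> (cylinder \<sigma>) \<le> (1 / 2) ^ (q + 1)"
  shows "measure \<mu> (\<Union>{cylinder \<sigma> | \<sigma> q. i \<le> q \<and> f q = Some (str_code \<sigma>) \<and> P \<sigma> q}) \<le> (1 / 2) ^ i"
    (is "measure \<mu> ?V \<le> _")
proof -
  interpret prob_space \<mu> using \<mu> by (simp add: cantor_measure_def)
  define A where "A k = \<Union>{cylinder \<sigma> | \<sigma>. f (k + i) = Some (str_code \<sigma>) \<and> P \<sigma> (k + i)}" for k
  have A: "A k = {} \<or> (\<exists>\<sigma>. P \<sigma> (k + i) \<and> A k = cylinder \<sigma>)" for k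
  proof (cases "\<exists>\<sigma>. f (k + i) = Some (str_code \<sigma>) \<and> P \<sigma> (k + i)")
    case True
    then obtain \<sigma> where \<sigma>: "f (k + i) = Some (str_code \<sigma>)" "P \<sigma> (k + i)" by blast
    then have "A k = cylinder \<sigma>" by (auto simp: A_def str_code_eq_iff)
    with \<sigma> show ?thesis by blast
  qed (auto simp: A_def)
  have A_le: "measure \<mu> (A k) \<le> (1 / 2) ^ (k + i + 1)" for k
    using A[of k] small[of _ "k + i"] by (metis measure_empty zero_le_power zero_le_divide_1_iff zero_le_numeral)
  have A_sets: "A k \<in> sets \<mu>" for k
    using A[of k] sets_cylinder[OF \<mu>] by (metis sets.empty_sets)
  have geo: "(\<lambda>k. (1 / 2 :: real) ^ (k + i + 1)) sums (1 / 2) ^ i"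
    using sums_mult[OF geometric_sums[of "1 / 2 :: real"], of "(1 / 2) ^ (i + 1)"]
    by (simp add: power_add mult_ac)
  have A_summable: "summable (\<lambda>k. measure \<mu> (A k))"
    using A_le by (intro summable_comparison_test'[OF sums_summable[OF geo], of 0]) auto
  have "?V = (\<Union>k. A k)"
  proof (intro equalityI subsetI)
    fix X assume "X \<in> ?V"
    then obtain \<sigma> q where "X \<in> cylinder \<sigma>" "i \<le> q" "f q = Some (str_code \<sigma>)" "P \<sigma> q" by blast
    then have "X \<in> A (q - i)" by (auto simp: A_def)
    then show "X \<in> (\<Union>k. A k)" by blast
  next
    fix X assume "X \<in> (\<Union>k. A k)"
    then obtain k \<sigma> where "X \<in> cylinder \<sigma>" "f (k + i) = Some (str_code \<sigma>)" "P \<sigma> (k + i)"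
      by (auto simp: A_def)
    then show "X \<in> ?V" using le_add2 by blast
  qed
  also have "measure \<mu> (\<Union>k. A k) \<le> (\<Sum>k. measure \<mu> (A k))"
    using A_sets A_summable by (intro finite_measure_subadditive_countably) auto
  also have "\<dots> \<le> (1 / 2) ^ i"
    using suminf_le[OF A_le A_summable sums_summable[OF geo]] sums_unique[OF geo] by simp
  finally show ?thesis .
qed

section \<open>Random sequences are complex\<close>

theorem theorem3p2:
  fixes U :: "bool list \<rightharpoonup> bool list"
    and X :: "nat \<Rightarrow> bool"
  assumes "universal_prefix_free_machine U"
    and "\<exists>\<mu>. cantor_measure \<mu> \<and> computable_measure \<mu> \<and> continuous_measure \<mu> \<and> ml_random \<mu> X"
  shows "complex_sequence U X"
proof -
  obtain \<mu> where \<mu>: "cantor_measure \<mu>" "computable_measure \<mu>" "continuous_measure \<mu>"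
    and random: "ml_random \<mu> X" using assms(2) by blast
  obtain \<phi> where \<phi>: "partial_recursive \<phi>" "\<And>\<sigma>. \<phi> (str_code \<sigma>) = map_option str_code (U \<sigma>)"
    using assms(1)
    by (auto simp: universal_prefix_free_machine_def prefix_free_machine_def partial_computable_def)
  obtain t where t: "computable t"
    and t_sound: "\<And>\<sigma> q. t (prod_encode (str_code \<sigma>, q)) = 0 \<Longrightarrow>
        measure \<mu> (cylinder \<sigma>) \<le> (1 / 2) ^ (q + 1)"
    and t_complete: "\<And>\<sigma> q. measure \<mu> (cylinder \<sigma>) \<le> (1 / 2) ^ (q + 2) \<Longrightarrow>
        t (prod_encode (str_code \<sigma>, q)) = 0"
    using computable_threshold_test[OF \<mu>(2)[unfolded computable_measure_def]] by blast
  define V where "V i = \<Union>{cylinder \<sigma> | \<sigma> q. i \<le> q \<and> \<phi> q = Some (str_code \<sigma>) \<and>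
      t (prod_encode (str_code \<sigma>, q)) = 0}" for i
  have "ml_test \<mu> V"
    unfolding ml_test_def V_def[abs_def]
  proof (intro conjI allI)
    fix i
    show "measure \<mu> (\<Union>{cylinder \<sigma> | \<sigma> q. i \<le> q \<and> \<phi> q = Some (str_code \<sigma>) \<and>
        t (prod_encode (str_code \<sigma>, q)) = 0}) \<le> (1 / 2) ^ i"
      by (rule measure_Union_outputs_le[OF \<mu>(1), where P = "\<lambda>\<sigma> q. t (prod_encode (str_code \<sigma>, q)) = 0"])
        (rule t_sound)
  qed (rule uniformly_sigma01_machine_outputs[OF \<phi>(1) t])
  with random obtain i where i: "X \<notin> V i" by (auto simp: ml_random_def)
  \<comment> \<open>Passing the test for \<open>q + 1\<close> implies the bound that guarantees passing the test for \<open>q\<close>. This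
    loss of one step allows the results of a finite search to be transferred to all extensions.\<close>
  have "\<exists>b. \<forall>s\<ge>b. t (prod_encode (s, Suc q)) = 0" for q
  proof -
    obtain n where n: "\<And>X. measure \<mu> (cylinder (init_seg X n)) \<le> (1 / 2) ^ (Suc q + 2)"
      using ex_length_measure_cylinder_le[OF \<mu>(1,3), of "(1 / 2) ^ (Suc q + 2)"] by auto
    have "finite {\<sigma> :: bool list. length \<sigma> \<le> n}"
      using finite_lists_length_le[of "UNIV :: bool set" n] by simp
    then obtain b where b: "\<And>\<sigma>. length \<sigma> \<le> n \<Longrightarrow> str_code \<sigma> < b"
      using finite_nat_set_iff_bounded[of "str_code ` {\<sigma>. length \<sigma> \<le> n}"] by auto
    have "t (prod_encode (s, Suc q)) = 0" if "b \<le> s" for s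
    proof -
      obtain \<sigma> where \<sigma>: "s = str_code \<sigma>" by (rule obtain_str_code)
      with b that have "n \<le> length \<sigma>" by (meson leD nle_le)
      define Y where "Y i = \<sigma> ! i" for i
      have "init_seg Y n = take n \<sigma>"
        using \<open>n \<le> length \<sigma>\<close> by (intro nth_equalityI) (simp_all add: Y_def init_seg_def)
      then have "measure \<mu> (cylinder \<sigma>) \<le> measure \<mu> (cylinder (init_seg Y n))"
        by (simp add: measure_cylinder_mono[OF \<mu>(1)] take_is_prefix)
      also have "\<dots> \<le> (1 / 2) ^ (Suc q + 2)" by (rule n)
      finally show ?thesis unfolding \<sigma> by (rule t_complete)
    qed
    then show ?thesis by blast
  qed
  moreover have "computable (\<lambda>x. t (prod_encode (fst (prod_decode x), Suc (snd (prod_decode x)))))"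
    by (intro computable_comp[OF t] computable_arith)
  ultimately obtain g where g: "computable g"
    and g_test: "\<And>q s. g q \<le> s \<Longrightarrow> s \<le> 2 * g q \<Longrightarrow> t (prod_encode (s, Suc q)) = 0"
    using computable_bounded_all_search[of
        "\<lambda>x. t (prod_encode (fst (prod_decode x), Suc (snd (prod_decode x))))"]
    by auto
  have passes: "t (prod_encode (str_code \<sigma>, q)) = 0" if "g q \<le> str_code \<sigma>" for \<sigma> q
  proof -
    obtain \<rho> where \<rho>: "prefix \<rho> \<sigma>" "g q \<le> str_code \<rho>" "str_code \<rho> \<le> 2 * g q"
      using ex_prefix_str_code_between[OF \<open>g q \<le> str_code \<sigma>\<close>] by blast
    have "measure \<mu> (cylinder \<sigma>) \<le> measure \<mu> (cylinder \<rho>)"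
      by (rule measure_cylinder_mono[OF \<mu>(1) \<rho>(1)])
    also have "\<dots> \<le> (1 / 2) ^ (q + 2)" using t_sound[OF g_test[OF \<rho>(2,3)]] by simp
    finally show ?thesis by (rule t_complete)
  qed
  obtain f where f: "order_function f" "computable f"
    and f_le: "\<And>n q. n < g q \<Longrightarrow> f n \<le> code_length q"
    using ex_order_below[OF g] by blast
  have long: "f n \<le> length p" if "U p = Some (init_seg X n)" "i \<le> str_code p" for n p
  proof -
    have "t (prod_encode (str_code (init_seg X n), str_code p)) \<noteq> 0"
    proof
      assume "t (prod_encode (str_code (init_seg X n), str_code p)) = 0"
      moreover have "\<phi> (str_code p) = Some (str_code (init_seg X n))" using \<phi>(2) that(1) by simp
      ultimately have "cylinder (init_seg X n) \<subseteq> V i" using that(2) unfolding V_def by blast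
      with i mem_cylinder_init_seg show False by blast
    qed
    then have "str_code (init_seg X n) < g (str_code p)"
      using passes[where \<sigma> = "init_seg X n" and q = "str_code p"] by (meson not_le)
    then have "n < g (str_code p)"
      using length_le_str_code[of "init_seg X n"] by (simp add: init_seg_def)
    from f_le[OF this] show ?thesis by (simp add: code_length_str_code)
  qed
  have "finite {p. str_code p < i}"
    using finite_vimageI[of "{..<i}" str_code] bij_str_code by (simp add: vimage_def bij_def)
  then obtain N where N: "\<And>p. str_code p < i \<Longrightarrow> length (the (U p)) \<le> N"
    using finite_nat_set_iff_bounded_le[of "(\<lambda>p. length (the (U p))) ` {p. str_code p < i}"] by auto
  \<comment> \<open>Truncated subtraction makes the bound 0 up to length \<open>N\<close>, where outputs of programs
    below \<open>i\<close> may occur; for longer segments it is at most the bound \<open>f n\<close>.\<close>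
  define f' where "f' n = f (n - N)" for n
  have "f' n \<le> length p" if p: "U p = Some (init_seg X n)" for n p
  proof (cases "i \<le> str_code p")
    case True
    have "f' n \<le> f n" using f(1) by (simp add: f'_def order_function_def monoD)
    also have "\<dots> \<le> length p" by (rule long[OF p True])
    finally show ?thesis .
  next
    case False
    then have "n \<le> N" using N[of p] p by (simp add: init_seg_def)
    then show ?thesis using f(1) by (simp add: f'_def order_function_def)
  qed
  then have "enat (f' n) \<le> complexity U (init_seg X n)" for n
    unfolding complexity_def by (intro INF_greatest) auto
  moreover have "order_function f'"
    unfolding order_function_def
  proof (intro conjI allI)
    show "mono f'" using f(1) by (auto simp: f'_def order_function_def mono_def)
    fix m
    obtain n where "m \<le> f n" using f(1) by (auto simp: order_function_def)
    then have "m \<le> f' (n + N)" by (simp add: f'_def)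
    then show "\<exists>n. m \<le> f' n" ..
    show "f' 0 = 0" using f(1) by (simp add: f'_def order_function_def)
  qed
  moreover have "computable f'"
    unfolding f'_def[abs_def] by (intro computable_comp[OF f(2)] computable_arith)
  ultimately show ?thesis unfolding complex_sequence_def by blast
qed

end
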